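(* Let $\mathbf{P}$ be the solution to the algebraic Riccati equation $$\mathbf{0}=-\mathbf{A}^{\top}\mathbf{P}-\mathbf{P}\mathbf{A}+\mathbf{P}\mathbf{M}\mathbf{U}^{-1}\mathbf{M}^{\top}\mathbf{P}-\mathbf{X}_g,\qquad \mathbf{X}_g=\begin{pmatrix}\mathbf{X}&\mathbf{0}\\ \mathbf{0}&\mathbf{0}\end{pmatrix},$$ partitioned conformally with $\mathbf{g}=(\mathbf{f},\mathbf{u})$ as $$\mathbf{P}=\begin{pmatrix}\mathbf{P}_{11}&\mathbf{P}_{12}\\ \mathbf{P}_{12}^{\top}&\mathbf{P}_{22}\end{pmatrix},$$ and let $\hat{\mathbf{g}}(t)$ be the Kalman filter estimate of $\mathbf{g}(t)$. Then the control law $\mathbf{c}(t)=-\mathbf{U}^{-1}\mathbf{M}^{\top}\mathbf{P}\,\hat{\mathbf{g}}(t)$ can be written as $$\mathbf{c}(t)=-\begin{pmatrix}\mathbf{U}^{-1}\mathbf{M}_f^{\top}\mathbf{P}_f & \mathbf{U}^{-1}\mathbf{M}_f^{\top}\mathbf{P}_{12}\end{pmatrix}\hat{\mathbf{g}}(t),$$ where $\mathbf{U}^{-1}\mathbf{M}_f^{\top}\mathbf{P}_f$ is just the gain of the non-forced case, that is, $\mathbf{P}_f=\mathbf{P}_{11}$ is the solution to the algebraic Riccati equation of the non-forced physical model, $$\mathbf{0}=-\mathbf{A}_f^{\top}\mathbf{P}_f-\mathbf{P}_f\mathbf{A}_f+\mathbf{P}_f\mathbf{M}_f\mathbf{U}^{-1}\mathbf{M}_f^{\top}\mathbf{P}_f-\mathbf{X},$$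 and $\mathbf{P}_{12}$ can be solved from the Sylvester equation $$\left(\mathbf{P}_f\mathbf{M}_f\mathbf{U}^{-1}\mathbf{M}_f^{\top}-\mathbf{A}_f^{\top}\right)\mathbf{P}_{12}-\mathbf{P}_{12}\mathbf{A}_u=\mathbf{P}_f\mathbf{B}_f\mathbf{C}_u .$$
   Context: A controlled latent force model has a physical part with state $\mathbf{f}(t)$ and a latent force part (a state-space representation of a Gaussian process input) with state $\mathbf{u}(t)$: $$\dot{\mathbf{f}}=\mathbf{A}_f\mathbf{f}+\mathbf{B}_f\mathbf{C}_u\mathbf{u}+\mathbf{M}_f\mathbf{c},\qquad \dot{\mathbf{u}}=\mathbf{A}_u\mathbf{u}+\mathbf{B}_u\mathbf{w},$$ where $\mathbf{A}_f,\mathbf{B}_f,\mathbf{M}_f,\mathbf{A}_u,\mathbf{B}_u,\mathbf{C}_u$ are constant real matrices of compatible dimensions, $\mathbf{w}$ is a vector-valued white noise and $\mathbf{c}$ is the control. Noisy measurements $\mathbf{y}_k=\mathbf{C}_f\mathbf{f}(t_k)+\boldsymbol{\epsilon}_k$ with Gaussian noise $\boldsymbol{\epsilon}_k$ are processed by a Kalman filter. The augmented state is $\mathbf{g}=(\mathbf{f},\mathbf{u})$, with $$\mathbf{A}=\begin{pmatrix}\mathbf{A}_f&\mathbf{B}_f\mathbf{C}_u\\ \mathbf{0}&\mathbf{A}_u\end{pmatrix},\qquad \mathbf{M}=\begin{pmatrix}\mathbf{M}_f\\ \mathbf{0}\end{pmatrix}.$$ The control problem is the infinite-time linear quadratic regulation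 problem (the limit $T\to\infty$ of the problem on $[0,T]$) with running cost $\mathbf{f}^{\top}\mathbf{X}\mathbf{f}+\mathbf{c}^{\top}\mathbf{U}\mathbf{c}$ integrated over $t\in[0,\infty)$, where $\mathbf{X}$ and $\mathbf{U}$ are constant symmetric positive semidefinite matrices and $\mathbf{U}$ is invertible. The non-forced problem is the same regulation problem for the physical model without the latent force, $\dot{\mathbf{f}}=\mathbf{A}_f\mathbf{f}+\mathbf{M}_f\mathbf{c}$. *)

theory Defs
  imports "HOL-Analysis.Analysis"
begin

section \<open>Block matrices\<close>

definition block_row :: "real^'a^'i \<Rightarrow> real^'b^'i \<Rightarrow> real^('a::finite + 'b::finite)^'i" where
  "block_row P Q = (\<chi> i j. case j of Inl a \<Rightarrow> P $ i $ a | Inr b \<Rightarrow> Q $ i $ b)"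

definition block_col :: "real^'j^'a \<Rightarrow> real^'j^'b \<Rightarrow> real^'j^('a::finite + 'b::finite)" where
  "block_col P Q = (\<chi> i. case i of Inl a \<Rightarrow> P $ a | Inr b \<Rightarrow> Q $ b)"

definition block_matrix ::
  "real^'a^'c \<Rightarrow> real^'b^'c \<Rightarrow> real^'a^'d \<Rightarrow> real^'b^'d
    \<Rightarrow> real^('a::finite + 'b::finite)^('c::finite + 'd::finite)" where
  "block_matrix P Q R S = block_col (block_row P Q) (block_row R S)"

definition psd_matrix :: "real^'n^'n \<Rightarrow> bool" where
  "psd_matrix S \<longleftrightarrow> transpose S = S \<and> (\<forall>x. 0 \<le> x \<bullet> (S *v x))"


section \<open>Linear quadratic regulation\<close>

definition riccati_equation ::
  "real^'n^'n \<Rightarrow> real^'c^'n \<Rightarrow> real^'n^'n \<Rightarrow> real^'c^'c \<Rightarrow> real^'n^'n \<Rightarrow> bool" where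
  "riccati_equation A M X U P \<longleftrightarrow>
     0 = - (transpose A ** P) - P ** A
         + P ** M ** matrix_inv U ** transpose M ** P - X"

text \<open>Pairs of a square integrable control \<open>c\<close> on \<open>[0,T]\<close> and the resulting (Caratheodory)
  solution \<open>x\<close> of \<open>x' = A x + M c\<close>, \<open>x 0 = x0\<close>.  The driving white noise is absent: the Riccati
  equation is that of the deterministic regulator, which the filter estimate is then fed into.\<close>

definition lq_trajectory ::
  "real^'n^'n \<Rightarrow> real^'c^'n \<Rightarrow> real \<Rightarrow> real^'n \<Rightarrow> (real \<Rightarrow> real^'n) \<Rightarrow> (real \<Rightarrow> real^'c) \<Rightarrow> bool"
  where
  "lq_trajectory A M T x0 x c \<longleftrightarrow>
     c \<in> borel_measurable (lebesgue_on {0..T}) \<and>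
     (\<lambda>t. (norm (c t))\<^sup>2) integrable_on {0..T} \<and>
     (\<forall>t\<in>{0..T}. ((\<lambda>s. A *v x s + M *v c s) has_integral (x t - x0)) {0..t})"

definition lq_cost ::
  "real^'n^'n \<Rightarrow> real^'c^'c \<Rightarrow> real \<Rightarrow> (real \<Rightarrow> real^'n) \<Rightarrow> (real \<Rightarrow> real^'c) \<Rightarrow> real" where
  "lq_cost X U T x c = integral {0..T} (\<lambda>t. x t \<bullet> (X *v x t) + c t \<bullet> (U *v c t))"

definition lq_value ::
  "real^'n^'n \<Rightarrow> real^'c^'n \<Rightarrow> real^'n^'n \<Rightarrow> real^'c^'c \<Rightarrow> real \<Rightarrow> real^'n \<Rightarrow> real" where
  "lq_value A M X U T x0 = Inf {lq_cost X U T x c | x c. lq_trajectory A M T x0 x c}"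

text \<open>An algebraic Riccati equation may have several solutions.  The one belonging to the
  infinite-time regulation problem is the symmetric solution whose quadratic form is the limit, as
  \<open>T\<close> tends to infinity, of the optimal cost on \<open>[0,T]\<close>; symmetry makes it unique.\<close>

definition lqr_riccati_solution ::
  "real^'n^'n \<Rightarrow> real^'c^'n \<Rightarrow> real^'n^'n \<Rightarrow> real^'c^'c \<Rightarrow> real^'n^'n \<Rightarrow> bool" where
  "lqr_riccati_solution A M X U P \<longleftrightarrow>
     riccati_equation A M X U P \<and> transpose P = P \<and>
     (\<forall>x0. ((\<lambda>T. lq_value A M X U T x0) \<longlongrightarrow> x0 \<bullet> (P *v x0)) at_top)"

lemma lqr_riccati_solution_unique:
  assumes P: "lqr_riccati_solution A M X U P" and Q: "lqr_riccati_solution A M X U Q"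
  shows "P = Q"
proof -
  have eq: "x \<bullet> (P *v x) = x \<bullet> (Q *v x)" for x
    using P Q unfolding lqr_riccati_solution_def
    by (meson tendsto_unique trivial_limit_at_top_linorder)
  have sym: "y \<bullet> (S *v x) = x \<bullet> (S *v y)" if "transpose S = S" for S :: "real^'n^'n" and x y
    by (metis that dot_lmul_matrix inner_commute transpose_matrix_vector)
  have "x \<bullet> (P *v y) = x \<bullet> (Q *v y)" for x y
    using eq[of "x + y"] eq[of x] eq[of y] sym[of P x y] sym[of Q x y] P Q
    unfolding lqr_riccati_solution_def
    by (simp add: matrix_vector_right_distrib inner_add_left inner_add_right)
  then have "P *v y = Q *v y" for y
    by (metis vector_eq_ldot)
  then show ?thesis
    by (simp add: matrix_eq)
qed


section \<open>Kalman filter\<close>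

text \<open>The measurements \<open>y k\<close> at times \<open>\<tau> k\<close> are indexed by an arbitrary, finite or infinite,
  set \<open>N\<close>.  A measurement at time \<open>0\<close> is covered by absorbing it into the prior.\<close>

definition measurement_times :: "nat set \<Rightarrow> (nat \<Rightarrow> real) \<Rightarrow> bool" where
  "measurement_times N \<tau> \<longleftrightarrow>
     strict_mono_on N \<tau> \<and> (\<forall>k\<in>N. 0 < \<tau> k) \<and> (\<forall>b. finite {k \<in> N. \<tau> k \<le> b})"

text \<open>Continuous-discrete Kalman filter for \<open>x' = A x + B w + M c\<close>, \<open>y k = H x (\<tau> k) + \<epsilon> k\<close>, where
  the white noise \<open>w\<close> has spectral density \<open>Q\<close>, the noise \<open>\<epsilon> k\<close> has covariance \<open>R k\<close> and the prior
  at time \<open>0\<close> has mean \<open>m0\<close> and covariance \<open>V0\<close>.  The estimate \<open>m\<close> (with error covariance \<open>V\<close>) is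
  right-continuous: at \<open>\<tau> k\<close> it already includes \<open>y k\<close>, and the left limits \<open>m'\<close>, \<open>V'\<close> are the
  predicted mean and covariance.\<close>

definition kalman_filter_estimate ::
  "real^'n^'n \<Rightarrow> real^'w^'n \<Rightarrow> real^'c^'n \<Rightarrow> real^'w^'w \<Rightarrow> real^'n^'m \<Rightarrow> (nat \<Rightarrow> real^'m^'m)
    \<Rightarrow> real^'n \<Rightarrow> real^'n^'n \<Rightarrow> nat set \<Rightarrow> (nat \<Rightarrow> real) \<Rightarrow> (nat \<Rightarrow> real^'m)
    \<Rightarrow> (real \<Rightarrow> real^'c) \<Rightarrow> (real \<Rightarrow> real^'n) \<Rightarrow> bool" where
  "kalman_filter_estimate A B M Q H R m0 V0 N \<tau> y c m \<longleftrightarrow>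
     (\<exists>V. m 0 = m0 \<and> V 0 = V0 \<and>
       (\<forall>t\<ge>0. continuous (at_right t) m \<and> continuous (at_right t) V) \<and>
       (\<forall>t>0. t \<notin> \<tau> ` N \<longrightarrow>
          (m has_vector_derivative (A *v m t + M *v c t)) (at t) \<and>
          (V has_vector_derivative
             (A ** V t + V t ** transpose A + B ** Q ** transpose B)) (at t)) \<and>
       (\<forall>k\<in>N. \<exists>m' V'.
          (m \<longlongrightarrow> m') (at_left (\<tau> k)) \<and> (V \<longlongrightarrow> V') (at_left (\<tau> k)) \<and>
          (let S = H ** V' ** transpose H + R k;
               K = V' ** transpose H ** matrix_inv S
           in invertible S \<and>
              m (\<tau> k) = m' + K *v (y k - H *v m') \<and>
              V (\<tau> k) = V' - K ** S ** transpose K)))"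

end

theory Submission
  imports Defs
begin

text \<open>The block equations of the Riccati equation are read off by multiplying out.  For the
  infinite-time regulation property, start the augmented model in a state without latent force:
  \<open>u' = A\<^sub>u u\<close>, \<open>u 0 = 0\<close> forces \<open>u = 0\<close>, so the trajectories are exactly those of the physical
  model, with the same costs.\<close>

section \<open>Algebra of block matrices\<close>

text \<open>This is what makes block multiplication work: the inner sum of a matrix product over a
  sum type falls apart into one product per block.\<close>

lemma sum_UNIV_Plus:
  fixes g :: "'a::finite + 'b::finite \<Rightarrow> 'c::comm_monoid_add"
  shows "(\<Sum>i\<in>UNIV. g i) = (\<Sum>a\<in>UNIV. g (Inl a)) + (\<Sum>b\<in>UNIV. g (Inr b))"
proof -
  have "(\<Sum>i\<in>UNIV. g i) = sum g (UNIV <+> UNIV)"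
    by simp
  also have "\<dots> = (\<Sum>a\<in>UNIV. g (Inl a)) + (\<Sum>b\<in>UNIV. g (Inr b))"
    by (subst sum.Plus) (simp_all add: comp_def)
  finally show ?thesis .
qed

lemmas block_defs = block_matrix_def block_col_def block_row_def

lemma transpose_block_matrix:
  "transpose (block_matrix P Q R S)
    = block_matrix (transpose P) (transpose R) (transpose Q) (transpose S)"
  by (simp add: block_defs vec_eq_iff split_sum_all transpose_def)

lemma transpose_block_col: "transpose (block_col P Q) = block_row (transpose P) (transpose Q)"
  by (simp add: block_defs vec_eq_iff split_sum_all transpose_def)

lemma block_matrix_mult_block_matrix:
  "block_matrix P Q R S ** block_matrix P' Q' R' S'
    = block_matrix (P ** P' + Q ** R') (P ** Q' + Q ** S') (R ** P' + S ** R') (R ** Q' + S ** S')"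
  by (simp add: block_defs vec_eq_iff split_sum_all matrix_matrix_mult_def sum_UNIV_Plus)

lemma block_matrix_mult_block_col:
  "block_matrix P Q R S ** block_col P' Q' = block_col (P ** P' + Q ** Q') (R ** P' + S ** Q')"
  by (simp add: block_defs vec_eq_iff split_sum_all matrix_matrix_mult_def sum_UNIV_Plus)

lemma block_row_mult_block_matrix:
  "block_row P Q ** block_matrix P' Q' R' S' = block_row (P ** P' + Q ** R') (P ** Q' + Q ** S')"
  by (simp add: block_defs vec_eq_iff split_sum_all matrix_matrix_mult_def sum_UNIV_Plus)

lemma block_col_mult: "block_col P Q ** S = block_col (P ** S) (Q ** S)"
  by (simp add: block_defs vec_eq_iff split_sum_all matrix_matrix_mult_def)

lemma mult_block_row: "S ** block_row P Q = block_row (S ** P) (S ** Q)"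
  by (simp add: block_defs vec_eq_iff split_sum_all matrix_matrix_mult_def)

lemma block_row_block_col:
  "block_row (block_col P R) (block_col Q S) = block_matrix P Q R S"
  by (simp add: block_defs vec_eq_iff split_sum_all)

lemma block_matrix_add:
  "block_matrix P Q R S + block_matrix P' Q' R' S' = block_matrix (P + P') (Q + Q') (R + R') (S + S')"
  by (simp add: block_defs vec_eq_iff split_sum_all)

lemma block_matrix_diff:
  "block_matrix P Q R S - block_matrix P' Q' R' S' = block_matrix (P - P') (Q - Q') (R - R') (S - S')"
  by (simp add: block_defs vec_eq_iff split_sum_all)

lemma block_matrix_uminus:
  "- block_matrix P Q R S = block_matrix (- P) (- Q) (- R) (- S)"
  by (simp add: block_defs vec_eq_iff split_sum_all)

lemma block_matrix_eq_iff:
  "block_matrix P Q R S = block_matrix P' Q' R' S' \<longleftrightarrow> P = P' \<and> Q = Q' \<and> R = R' \<and> S = S'"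
  by (auto simp add: block_defs vec_eq_iff split_sum_all)

lemma block_matrix_zero: "block_matrix 0 0 0 0 = 0"
  by (simp add: block_defs vec_eq_iff split_sum_all)

lemma matrix_mult_zero [simp]:
  "(0 :: real^'n^'m) ** S = 0" "T ** (0 :: real^'n^'m) = 0"
  by (simp_all add: vec_eq_iff matrix_matrix_mult_def)

lemma matrix_mult_diff_left: "(S - T) ** V = S ** V - T ** (V :: real^'n^'m)"
  by (simp add: vec_eq_iff matrix_matrix_mult_def left_diff_distrib sum_subtractf)

lemma transpose_zero: "transpose (0 :: real^'n^'m) = 0"
  by (simp add: vec_eq_iff transpose_def)

section \<open>Block components of the Riccati equation\<close>

text \<open>The upper two blocks decouple from the lower ones. The transpose of the block triangular
  matrix has a zero upper right block, so the lower blocks of the solution do not enter; the zero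
  lower left block keeps \<open>P\<^sub>1\<^sub>2\<close> out of the equation for
  \<open>P\<^sub>1\<^sub>1\<close>; and the zero block of the control matrix leaves only
  \<open>P\<^sub>1\<^sub>1\<close> and \<open>P\<^sub>1\<^sub>2\<close> in the upper half of the
  quadratic term.\<close>

lemma riccati_equation_block:
  assumes "riccati_equation (block_matrix A\<^sub>f D 0 A\<^sub>u) (block_col M\<^sub>f 0) (block_matrix X 0 0 0) U
             (block_matrix P\<^sub>1\<^sub>1 P\<^sub>1\<^sub>2 P\<^sub>2\<^sub>1 P\<^sub>2\<^sub>2)"
  shows "riccati_equation A\<^sub>f M\<^sub>f X U P\<^sub>1\<^sub>1"
    and "(P\<^sub>1\<^sub>1 ** M\<^sub>f ** matrix_inv U ** transpose M\<^sub>f - transpose A\<^sub>f) ** P\<^sub>1\<^sub>2 - P\<^sub>1\<^sub>2 ** A\<^sub>u = P\<^sub>1\<^sub>1 ** D"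
proof -
  have eqs: "0 = - (transpose A\<^sub>f ** P\<^sub>1\<^sub>1) - P\<^sub>1\<^sub>1 ** A\<^sub>f
                + P\<^sub>1\<^sub>1 ** M\<^sub>f ** matrix_inv U ** transpose M\<^sub>f ** P\<^sub>1\<^sub>1 - X
           \<and> 0 = - (transpose A\<^sub>f ** P\<^sub>1\<^sub>2) - (P\<^sub>1\<^sub>1 ** D + P\<^sub>1\<^sub>2 ** A\<^sub>u)
                + P\<^sub>1\<^sub>1 ** M\<^sub>f ** matrix_inv U ** transpose M\<^sub>f ** P\<^sub>1\<^sub>2"
    using assms
    unfolding riccati_equation_def
    \<comment> \<open>Reversed, \<open>block_matrix_zero\<close> rewrites only zeros indexed by sum
      types, in particular the left-hand side, so that \<open>block_matrix_eq_iff\<close> can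
      compare block by block.\<close>
    by (simp add: block_matrix_zero [symmetric] transpose_block_matrix transpose_block_col
        block_matrix_mult_block_matrix block_matrix_mult_block_col block_col_mult
        mult_block_row block_row_mult_block_matrix block_row_block_col
        block_matrix_add block_matrix_diff block_matrix_uminus
        block_matrix_eq_iff transpose_zero)
  from eqs show "riccati_equation A\<^sub>f M\<^sub>f X U P\<^sub>1\<^sub>1"
    unfolding riccati_equation_def by blast
  from eqs show "(P\<^sub>1\<^sub>1 ** M\<^sub>f ** matrix_inv U ** transpose M\<^sub>f - transpose A\<^sub>f) ** P\<^sub>1\<^sub>2 - P\<^sub>1\<^sub>2 ** A\<^sub>u
      = P\<^sub>1\<^sub>1 ** D"
    by (simp add: matrix_mult_diff_left algebra_simps)
qed

section \<open>Physical and latent components of an augmented state\<close>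

definition vec_append :: "real^'a \<Rightarrow> real^'b \<Rightarrow> real^('a::finite + 'b::finite)" where
  "vec_append x y = (\<chi> i. case i of Inl a \<Rightarrow> x $ a | Inr b \<Rightarrow> y $ b)"

definition vec_left :: "real^('a::finite + 'b::finite) \<Rightarrow> real^'a" where
  "vec_left z = (\<chi> a. z $ Inl a)"

definition vec_right :: "real^('a::finite + 'b::finite) \<Rightarrow> real^'b" where
  "vec_right z = (\<chi> b. z $ Inr b)"

lemmas vec_append_defs = vec_append_def vec_left_def vec_right_def

lemma vec_append_left_right: "vec_append (vec_left z) (vec_right z) = z"
  by (simp add: vec_append_defs vec_eq_iff split_sum_all)

lemma vec_left_append [simp]: "vec_left (vec_append x y) = x"
  by (simp add: vec_append_defs vec_eq_iff)

lemma vec_right_append [simp]: "vec_right (vec_append x y) = y"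
  by (simp add: vec_append_defs vec_eq_iff)

lemma vec_append_arith:
  "vec_append x y + vec_append x' y' = vec_append (x + x') (y + y')"
  "vec_append x y - vec_append x' y' = vec_append (x - x') (y - y')"
  by (simp_all add: vec_append_defs vec_eq_iff split_sum_all)

text \<open>Bounded linearity allows projections and embeddings to be moved through
  \<open>has_integral\<close>, and so through the integral form of the dynamics.\<close>

lemma bounded_linear_vec_left: "bounded_linear vec_left"
  unfolding linear_conv_bounded_linear [symmetric]
  by (rule linearI) (simp_all add: vec_left_def vec_eq_iff)

lemma bounded_linear_vec_right: "bounded_linear vec_right"
  unfolding linear_conv_bounded_linear [symmetric]
  by (rule linearI) (simp_all add: vec_right_def vec_eq_iff)

lemma bounded_linear_vec_append_zero: "bounded_linear (\<lambda>x. vec_append x 0)"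
  unfolding linear_conv_bounded_linear [symmetric]
  by (rule linearI) (simp_all add: vec_append_def vec_eq_iff split_sum_all)

lemma block_matrix_vec_append:
  "block_matrix P Q R S *v vec_append x y = vec_append (P *v x + Q *v y) (R *v x + S *v y)"
  by (simp add: block_defs vec_append_def vec_eq_iff split_sum_all matrix_vector_mult_def
      sum_UNIV_Plus)

lemma block_col_vec: "block_col P Q *v x = vec_append (P *v x) (Q *v x)"
  by (simp add: block_defs vec_append_def vec_eq_iff split_sum_all matrix_vector_mult_def)

lemma inner_vec_append: "vec_append x y \<bullet> vec_append x' y' = x \<bullet> x' + y \<bullet> y'"
  by (simp add: vec_append_def inner_vec_def sum_UNIV_Plus)

section \<open>Uniqueness for the homogeneous linear equation\<close>

text \<open>Trajectories are given only by an integral equation, so regularity has to be extracted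
  from it before a Gronwall argument can apply.\<close>

lemma linear_ode_zero:
  fixes S :: "real^'n^'n" and u :: "real \<Rightarrow> real^'n"
  assumes int: "\<forall>t\<in>{0..T}. ((\<lambda>s. S *v u s) has_integral u t) {0..t}"
    and t: "t \<in> {0..T}"
  shows "u t = 0"
proof -
  have T: "0 \<le> T" using t by simp
  have lin: "bounded_linear (\<lambda>x. S *v x)"
    by (simp add: linear_conv_bounded_linear [symmetric])
  have u_eq: "u t = integral {0..t} (\<lambda>s. S *v u s)" if "t \<in> {0..T}" for t
    using int that by (metis integral_unique)
  \<comment> \<open>Bootstrapping: an indefinite integral is continuous, hence so is
    \<open>u\<close>; then the integrand is continuous as well, and the fundamental theorem of
    calculus makes \<open>u\<close> differentiable.\<close>
  have "(\<lambda>s. S *v u s) integrable_on {0..T}"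
    using int T by (meson atLeastAtMost_iff has_integral_integrable order_refl)
  then have "continuous_on {0..T} (\<lambda>t. integral {0..t} (\<lambda>s. S *v u s))"
    by (rule indefinite_integral_continuous_1)
  then have cont: "continuous_on {0..T} u"
    by (rule continuous_on_eq) (simp add: u_eq)
  then have "continuous_on {0..T} (\<lambda>s. S *v u s)"
    by (rule bounded_linear.continuous_on [OF lin])
  then have "((\<lambda>t. integral {0..t} (\<lambda>s. S *v u s)) has_vector_derivative S *v u t)
      (at t within {0..T})" if "t \<in> {0..T}" for t
    using that by (rule integral_has_vector_derivative)
  then have deriv: "(u has_vector_derivative S *v u t) (at t within {0..T})"
    if "t \<in> {0..T}" for t
    using that u_eq by (metis (no_types, lifting) has_vector_derivative_transform)
  define K where "K = onorm (\<lambda>x. S *v x)"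
  have K: "norm (S *v x) \<le> K * norm x" for x
    unfolding K_def by (rule onorm [OF lin])
  \<comment> \<open>Gronwall's trick: the factor \<open>exp (- 2 K t)\<close> makes the squared norm nonincreasing.\<close>
  define \<phi> where "\<phi> t = exp (- 2 * K * t) * (u t \<bullet> u t)" for t
  have "\<phi> t \<le> \<phi> 0"
  proof (rule DERIV_nonpos_imp_decreasing_open [of 0 t \<phi>])
    show "0 \<le> t" using t by simp
  next
    fix s assume s: "0 < s" "s < t"
    \<comment> \<open>As \<open>0 < s < t \<le> T\<close>, the point is interior and the derivative
      within the interval is two-sided.\<close>
    then have "(u has_vector_derivative S *v u s) (at s)"
      using deriv [of s] t at_within_Icc_at [of 0 s T] by simp
    then have u': "(u has_derivative (\<lambda>h. h *\<^sub>R (S *v u s))) (at s)"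
      by (simp add: has_vector_derivative_def)
    have "((\<lambda>t. u t \<bullet> u t) has_real_derivative 2 * (u s \<bullet> (S *v u s))) (at s)"
      unfolding has_field_derivative_def
      by (rule has_derivative_eq_rhs [OF has_derivative_inner [OF u' u']])
        (auto simp: inner_commute)
    then have d: "(\<phi> has_real_derivative
        exp (- 2 * K * s) * (2 * (u s \<bullet> (S *v u s)) - 2 * K * (u s \<bullet> u s))) (at s)"
      unfolding \<phi>_def by (auto intro!: derivative_eq_intros simp: algebra_simps)
    have "u s \<bullet> (S *v u s) \<le> norm (u s) * norm (S *v u s)"
      by (rule norm_cauchy_schwarz)
    also have "\<dots> \<le> norm (u s) * (K * norm (u s))"
      by (intro mult_left_mono K) simp
    also have "\<dots> = K * (u s \<bullet> u s)"
      by (simp add: power2_norm_eq_inner [symmetric] power2_eq_square)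
    finally have "exp (- 2 * K * s) * (2 * (u s \<bullet> (S *v u s)) - 2 * K * (u s \<bullet> u s)) \<le> 0"
      by (simp add: mult_le_0_iff)
    with d show "\<exists>y. (\<phi> has_real_derivative y) (at s) \<and> y \<le> 0"
      by blast
  next
    show "continuous_on {0..t} \<phi>"
      unfolding \<phi>_def using t
      by (intro continuous_intros continuous_on_subset [OF cont]) auto
  qed
  \<comment> \<open>The initial value is built into the integral equation: at time 0 the integral
    runs over a single point.\<close>
  also have "\<phi> 0 = 0"
    using u_eq [of 0] T by (simp add: \<phi>_def)
  finally have "u t \<bullet> u t \<le> 0"
    by (simp add: \<phi>_def mult_le_0_iff)
  then show ?thesis
    by (metis inner_gt_zero_iff not_less)
qed

section \<open>Transfer of the regulation problem to the physical model\<close>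

text \<open>The augmented state weight does not see the latent component, so the costs agree for
  every \<open>x\<close>, whether or not that component vanishes.\<close>

lemma lq_cost_block:
  fixes x :: "real \<Rightarrow> real^('a::finite + 'b::finite)"
  shows "lq_cost (block_matrix X 0 0 0) U T x c = lq_cost X U T (\<lambda>t. vec_left (x t)) c"
proof -
  have "x t \<bullet> (block_matrix X 0 0 0 *v x t) = vec_left (x t) \<bullet> (X *v vec_left (x t))" for t
    using block_matrix_vec_append [of X 0 0 "0 :: real^'b^'b" "vec_left (x t)" "vec_right (x t)"]
      inner_vec_append [of "vec_left (x t)" "vec_right (x t)" "X *v vec_left (x t)" 0]
    by (simp add: vec_append_left_right)
  then show ?thesis by (simp add: lq_cost_def)
qed

text \<open>The latent equation receives no control and starts at zero; by
  \<open>linear_ode_zero\<close> its state stays zero, which removes the coupling through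
  \<open>D\<close>.\<close>

lemma lq_trajectory_vec_left:
  assumes "lq_trajectory (block_matrix A\<^sub>f D 0 A\<^sub>u) (block_col M\<^sub>f 0) T (vec_append f0 0) x c"
  shows "lq_trajectory A\<^sub>f M\<^sub>f T f0 (\<lambda>t. vec_left (x t)) c"
proof -
  let ?f = "\<lambda>t. vec_left (x t)" and ?u = "\<lambda>t. vec_right (x t)"
  have rhs: "block_matrix A\<^sub>f D 0 A\<^sub>u *v x s + block_col M\<^sub>f 0 *v c s
      = vec_append (A\<^sub>f *v ?f s + D *v ?u s + M\<^sub>f *v c s) (A\<^sub>u *v ?u s)" for s
    using block_matrix_vec_append [of A\<^sub>f D 0 A\<^sub>u "?f s" "?u s"]
    by (simp add: vec_append_left_right block_col_vec vec_append_arith)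
  have int: "((\<lambda>s. vec_append (A\<^sub>f *v ?f s + D *v ?u s + M\<^sub>f *v c s) (A\<^sub>u *v ?u s))
      has_integral vec_append (?f t - f0) (?u t)) {0..t}" if "t \<in> {0..T}" for t
  proof -
    have "x t - vec_append f0 0 = vec_append (?f t - f0) (?u t)"
      using vec_append_arith(2) [of "?f t" "?u t" f0 0] by (simp add: vec_append_left_right)
    moreover have "((\<lambda>s. vec_append (A\<^sub>f *v ?f s + D *v ?u s + M\<^sub>f *v c s) (A\<^sub>u *v ?u s))
        has_integral (x t - vec_append f0 0)) {0..t}"
      using assms that unfolding lq_trajectory_def rhs by blast
    ultimately show ?thesis by simp
  qed
  have "\<forall>t\<in>{0..T}. ((\<lambda>s. A\<^sub>u *v ?u s) has_integral ?u t) {0..t}"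
    using has_integral_linear [OF int bounded_linear_vec_right] by (simp add: comp_def)
  then have u0: "?u t = 0" if "t \<in> {0..T}" for t
    using that by (rule linear_ode_zero)
  have "((\<lambda>s. A\<^sub>f *v ?f s + M\<^sub>f *v c s) has_integral (?f t - f0)) {0..t}" if t: "t \<in> {0..T}" for t
  \<comment> \<open>Outside \<open>{0..T}\<close> the latent component is unconstrained, so the
    integrands are compared on \<open>{0..t}\<close> only.\<close>
  proof (rule has_integral_eq)
    show "((\<lambda>s. A\<^sub>f *v ?f s + D *v ?u s + M\<^sub>f *v c s) has_integral (?f t - f0)) {0..t}"
      using has_integral_linear [OF int [OF t] bounded_linear_vec_left] by (simp add: comp_def)
    show "A\<^sub>f *v ?f s + D *v ?u s + M\<^sub>f *v c s = A\<^sub>f *v ?f s + M\<^sub>f *v c s" if "s \<in> {0..t}" for s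
      using that t u0 by simp
  qed
  with assms show ?thesis
    unfolding lq_trajectory_def by blast
qed

text \<open>Conversely, the zero latent state solves its own equation for any
  \<open>A\<^sub>u\<close> and exerts no force.\<close>

lemma lq_trajectory_vec_append:
  fixes A\<^sub>u :: "real^'u^'u"
  assumes "lq_trajectory A\<^sub>f M\<^sub>f T f0 f c"
  shows "lq_trajectory (block_matrix A\<^sub>f D 0 A\<^sub>u) (block_col M\<^sub>f 0) T (vec_append f0 0)
    (\<lambda>t. vec_append (f t) 0) c"
proof -
  have "((\<lambda>s. vec_append (A\<^sub>f *v f s + M\<^sub>f *v c s) (0 :: real^'u))
      has_integral vec_append (f t - f0) 0) {0..t}"
    if "t \<in> {0..T}" for t
  proof -
    have "((\<lambda>s. A\<^sub>f *v f s + M\<^sub>f *v c s) has_integral (f t - f0)) {0..t}"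
      using assms that by (simp add: lq_trajectory_def)
    from has_integral_linear [OF this bounded_linear_vec_append_zero] show ?thesis
      by (simp add: comp_def)
  qed
  with assms show ?thesis
    unfolding lq_trajectory_def
    by (auto simp: block_matrix_vec_append block_col_vec vec_append_arith)
qed

text \<open>The sets of attainable costs are shown to be equal, so their infima agree without any
  discussion of minimisers.\<close>

lemma lq_value_block:
  fixes A\<^sub>u :: "real^'u^'u"
  shows "lq_value (block_matrix A\<^sub>f D 0 A\<^sub>u) (block_col M\<^sub>f 0) (block_matrix X 0 0 0) U T (vec_append f0 0)
    = lq_value A\<^sub>f M\<^sub>f X U T f0"
proof -
  let ?A = "block_matrix A\<^sub>f D 0 A\<^sub>u" and ?M = "block_col M\<^sub>f (0 :: real^_^'u)"
    and ?X = "block_matrix X 0 0 (0 :: real^'u^'u)"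
  have "{lq_cost ?X U T x c | x c. lq_trajectory ?A ?M T (vec_append f0 0) x c}
      = {lq_cost X U T f c | f c. lq_trajectory A\<^sub>f M\<^sub>f T f0 f c}" (is "?L = ?R")
  proof
    show "?L \<subseteq> ?R"
      using lq_trajectory_vec_left by (fastforce simp: lq_cost_block)
    show "?R \<subseteq> ?L"
    proof
      fix v assume "v \<in> ?R"
      then obtain f c where "v = lq_cost X U T f c" "lq_trajectory A\<^sub>f M\<^sub>f T f0 f c"
        by blast
      then have "v = lq_cost ?X U T (\<lambda>t. vec_append (f t) 0) c
          \<and> lq_trajectory ?A ?M T (vec_append f0 0) (\<lambda>t. vec_append (f t) 0) c"
        by (simp add: lq_cost_block lq_trajectory_vec_append)
      then show "v \<in> ?L" by blast
    qed
  qed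
  then show ?thesis by (simp add: lq_value_def)
qed

text \<open>Testing the limit property at states \<open>vec_append f0 0\<close> suffices: there the
  optimal costs are those of the physical model and the quadratic form reduces to its upper left
  block.\<close>

lemma lqr_riccati_solution_block:
  assumes "lqr_riccati_solution (block_matrix A\<^sub>f D 0 A\<^sub>u) (block_col M\<^sub>f 0) (block_matrix X 0 0 0) U
             (block_matrix P\<^sub>1\<^sub>1 P\<^sub>1\<^sub>2 P\<^sub>2\<^sub>1 P\<^sub>2\<^sub>2)"
  shows "lqr_riccati_solution A\<^sub>f M\<^sub>f X U P\<^sub>1\<^sub>1"
  unfolding lqr_riccati_solution_def
proof (intro conjI allI)
  show "riccati_equation A\<^sub>f M\<^sub>f X U P\<^sub>1\<^sub>1"
    using assms unfolding lqr_riccati_solution_def by (blast intro: riccati_equation_block(1))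
  show "transpose P\<^sub>1\<^sub>1 = P\<^sub>1\<^sub>1"
    using assms unfolding lqr_riccati_solution_def
    by (simp add: transpose_block_matrix block_matrix_eq_iff)
  fix f0
  have "((\<lambda>T. lq_value (block_matrix A\<^sub>f D 0 A\<^sub>u) (block_col M\<^sub>f 0) (block_matrix X 0 0 0) U T
        (vec_append f0 0)) \<longlongrightarrow>
      vec_append f0 0 \<bullet> (block_matrix P\<^sub>1\<^sub>1 P\<^sub>1\<^sub>2 P\<^sub>2\<^sub>1 P\<^sub>2\<^sub>2 *v vec_append f0 0)) at_top"
    using assms unfolding lqr_riccati_solution_def by blast
  then show "((\<lambda>T. lq_value A\<^sub>f M\<^sub>f X U T f0) \<longlongrightarrow> f0 \<bullet> (P\<^sub>1\<^sub>1 *v f0)) at_top"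
    by (simp add: lq_value_block block_matrix_vec_append inner_vec_append)
qed

text \<open>A Riccati equation may have several solutions. The two matrix equations hold for each
  solution of the given block form; the implication adds that the regulator's own solution for the
  augmented model restricts to that of the physical model, which identifies the first gain block as
  the non-forced gain.\<close>

theorem mainTheorem2:
  fixes A\<^sub>f :: "real^'f^'f" and B\<^sub>f :: "real^'l^'f" and M\<^sub>f :: "real^'c^'f"
    and A\<^sub>u :: "real^'u^'u" and B\<^sub>u :: "real^'w^'u" and C\<^sub>u :: "real^'u^'l"
    and C\<^sub>f :: "real^'f^'m"
    and X :: "real^'f^'f" and U :: "real^'c^'c"
    and A :: "real^('f + 'u)^('f + 'u)" and M :: "real^'c^('f + 'u)"
    and X\<^sub>g P :: "real^('f + 'u)^('f + 'u)"
    and P\<^sub>1\<^sub>1 :: "real^'f^'f" and P\<^sub>1\<^sub>2 :: "real^'u^'f" and P\<^sub>2\<^sub>2 :: "real^'u^'u"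
    and Q :: "real^'w^'w" and R :: "nat \<Rightarrow> real^'m^'m"
    and m0 :: "real^('f + 'u)" and V0 :: "real^('f + 'u)^('f + 'u)"
    and N :: "nat set" and \<tau> :: "nat \<Rightarrow> real" and y :: "nat \<Rightarrow> real^'m"
    and g_hat :: "real \<Rightarrow> real^('f + 'u)" and c :: "real \<Rightarrow> real^'c"
  assumes A_eq: "A = block_matrix A\<^sub>f (B\<^sub>f ** C\<^sub>u) 0 A\<^sub>u"
    and M_eq: "M = block_col M\<^sub>f 0"
    and Xg_eq: "X\<^sub>g = block_matrix X 0 0 0"
    and X: "psd_matrix X"
    and U: "psd_matrix U" "invertible U"
    and noise: "psd_matrix Q" "\<forall>k\<in>N. psd_matrix (R k)" "psd_matrix V0"
    and times: "measurement_times N \<tau>"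
    and P_riccati: "riccati_equation A M X\<^sub>g U P"
    and P_eq: "P = block_matrix P\<^sub>1\<^sub>1 P\<^sub>1\<^sub>2 (transpose P\<^sub>1\<^sub>2) P\<^sub>2\<^sub>2"
    and filter: "kalman_filter_estimate A (block_col 0 B\<^sub>u) M Q (block_row C\<^sub>f 0) R
                   m0 V0 N \<tau> y c g_hat"
    and control: "\<forall>t\<ge>0. c t = - ((matrix_inv U ** transpose M ** P) *v g_hat t)"
  shows "(\<forall>t\<ge>0. c t = - (block_row (matrix_inv U ** transpose M\<^sub>f ** P\<^sub>1\<^sub>1)
                                   (matrix_inv U ** transpose M\<^sub>f ** P\<^sub>1\<^sub>2) *v g_hat t))
    \<and> riccati_equation A\<^sub>f M\<^sub>f X U P\<^sub>1\<^sub>1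
    \<and> (lqr_riccati_solution A M X\<^sub>g U P \<longrightarrow> lqr_riccati_solution A\<^sub>f M\<^sub>f X U P\<^sub>1\<^sub>1)
    \<and> (P\<^sub>1\<^sub>1 ** M\<^sub>f ** matrix_inv U ** transpose M\<^sub>f - transpose A\<^sub>f) ** P\<^sub>1\<^sub>2 - P\<^sub>1\<^sub>2 ** A\<^sub>u
        = P\<^sub>1\<^sub>1 ** B\<^sub>f ** C\<^sub>u"
proof (intro conjI impI)
  \<comment> \<open>The zero block of \<open>M\<close> selects the upper block row of
    \<open>P\<close>.\<close>
  have gain: "matrix_inv U ** transpose M ** P
      = block_row (matrix_inv U ** transpose M\<^sub>f ** P\<^sub>1\<^sub>1) (matrix_inv U ** transpose M\<^sub>f ** P\<^sub>1\<^sub>2)"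
    by (simp add: M_eq P_eq transpose_block_col transpose_zero mult_block_row
        block_row_mult_block_matrix)
  show "\<forall>t\<ge>0. c t = - (block_row (matrix_inv U ** transpose M\<^sub>f ** P\<^sub>1\<^sub>1)
      (matrix_inv U ** transpose M\<^sub>f ** P\<^sub>1\<^sub>2) *v g_hat t)"
    using control unfolding gain .
  note riccati = riccati_equation_block [OF P_riccati [unfolded A_eq M_eq Xg_eq P_eq]]
  show "riccati_equation A\<^sub>f M\<^sub>f X U P\<^sub>1\<^sub>1"
    by (rule riccati(1))
  show "(P\<^sub>1\<^sub>1 ** M\<^sub>f ** matrix_inv U ** transpose M\<^sub>f - transpose A\<^sub>f) ** P\<^sub>1\<^sub>2 - P\<^sub>1\<^sub>2 ** A\<^sub>u
      = P\<^sub>1\<^sub>1 ** B\<^sub>f ** C\<^sub>u"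
    using riccati(2) by (simp add: matrix_mul_assoc)
  show "lqr_riccati_solution A\<^sub>f M\<^sub>f X U P\<^sub>1\<^sub>1" if "lqr_riccati_solution A M X\<^sub>g U P"
    using that unfolding A_eq M_eq Xg_eq P_eq by (rule lqr_riccati_solution_block)
qed

end
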